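(* There exist a $2$-$(1576,8,1)$ design and a $2$-$(2025,9,1)$ design.
   Context: A $2$-$(v,k,\lambda)$ design is a pair $(V,\mathcal{A})$ where $V$ is a set of $v$ points and $\mathcal{A}$ is a collection (multiset) of $k$-subsets of $V$ (blocks) such that every $2$-subset of $V$ is contained in exactly $\lambda$ blocks of $\mathcal{A}$. *)

theory Defs
  imports Main "HOL-Library.Multiset"
begin

definition two_design :: "nat \<Rightarrow> nat \<Rightarrow> nat \<Rightarrow> 'a set \<Rightarrow> 'a set multiset \<Rightarrow> bool" where
  "two_design v k l V \<A> \<longleftrightarrow>
     finite V \<and> card V = v \<and>
     (\<forall>B. B \<in># \<A> \<longrightarrow> B \<subseteq> V \<and> card B = k) \<and>
     (\<forall>T. T \<subseteq> V \<and> card T = 2 \<longrightarrow> size {#B \<in># \<A>. T \<subseteq> B#} = l)"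

end

theory Submission
  imports Defs "HOL-Library.FuncSet" "HOL-Library.Product_Plus"
begin

text \<open>A family of \<open>k\<close>-subsets that covers every pair of points and has at most
  \<open>(v choose 2) / (k choose 2)\<close> members covers every pair exactly once, so it suffices to cover
  pairs economically.

  Let \<open>G = F\<^sub>9 \<times> \<int>/m\<close> with \<open>m = 7\<close> or \<open>m = 9\<close>. The points are those of \<open>G \<times> F\<^sub>2\<^sub>5\<close>,
  with an additional point at infinity when \<open>m = 7\<close>. A cyclic group of order 24 acts linearly on
  \<open>G \<times> F\<^sub>2\<^sub>5\<close> and regularly on the nonzero elements of \<open>F\<^sub>2\<^sub>5\<close>. Two base blocks, one with orbit
  length 24 and one, invariant under the subgroup of order 8, with orbit length 3, give 27 blocks
  whose differences are exactly the elements with nonzero \<open>F\<^sub>2\<^sub>5\<close>-component; it suffices to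
  see this for the elements with \<open>F\<^sub>2\<^sub>5\<close>-component 1. Translates of these blocks cover the pairs
  in different fibres over \<open>F\<^sub>2\<^sub>5\<close>, and each fibre, with the point at infinity if there is one,
  is filled with an affine plane of order 8 or 9. The base blocks with orbit length 24 were found
  by a backtracking search.\<close>

section \<open>Pair coverings\<close>

text \<open>Only an upper bound on the number of blocks is recorded, so coinciding blocks and
  repeated coverage never have to be excluded. The relation \<open>r\<close> allows coverings of
  just some of the pairs.\<close>

definition pair_cover :: "('a \<Rightarrow> 'a \<Rightarrow> bool) \<Rightarrow> 'a set \<Rightarrow> nat \<Rightarrow> nat \<Rightarrow> bool" where
  "pair_cover r V k b \<longleftrightarrow>
     (\<exists>\<B>. finite \<B> \<and> card \<B> \<le> b \<and> (\<forall>B\<in>\<B>. B \<subseteq> V \<and> card B = k) \<and>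
          (\<forall>x\<in>V. \<forall>y\<in>V. r x y \<longrightarrow> (\<exists>B\<in>\<B>. x \<in> B \<and> y \<in> B)))"

lemma pair_coverI:
  assumes "finite \<B>" "card \<B> \<le> b" "\<And>B. B \<in> \<B> \<Longrightarrow> B \<subseteq> V" "\<And>B. B \<in> \<B> \<Longrightarrow> card B = k"
    and "\<And>x y. x \<in> V \<Longrightarrow> y \<in> V \<Longrightarrow> r x y \<Longrightarrow> \<exists>B\<in>\<B>. x \<in> B \<and> y \<in> B"
  shows "pair_cover r V k b"
  unfolding pair_cover_def by (rule exI[of _ \<B>]) (simp add: assms)

lemma pair_coverE:
  assumes "pair_cover r V k b"
  obtains \<B> where "finite \<B>" "card \<B> \<le> b" "\<forall>B\<in>\<B>. B \<subseteq> V" "\<forall>B\<in>\<B>. card B = k"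
    and "\<forall>x\<in>V. \<forall>y\<in>V. r x y \<longrightarrow> (\<exists>B\<in>\<B>. x \<in> B \<and> y \<in> B)"
  using assms unfolding pair_cover_def by (elim exE conjE) (rule that, simp_all)

lemma pair_cover_single:
  assumes "card V = k"
  shows "pair_cover r V k 1"
  by (rule pair_coverI[where \<B> = "{V}"]) (use assms in auto)

lemma pair_cover_bij:
  assumes f: "bij_betw f V W" and cov: "pair_cover (\<noteq>) V k b"
  shows "pair_cover (\<noteq>) W k b"
proof -
  have inj: "inj_on f V" and W: "W = f ` V"
    using f by (auto simp: bij_betw_def)
  from cov obtain \<B> where \<B>: "finite \<B>" "card \<B> \<le> b" "\<forall>B\<in>\<B>. B \<subseteq> V" "\<forall>B\<in>\<B>. card B = k"
      "\<forall>x\<in>V. \<forall>y\<in>V. x \<noteq> y \<longrightarrow> (\<exists>B\<in>\<B>. x \<in> B \<and> y \<in> B)"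
    by (rule pair_coverE)
  show ?thesis
  proof (rule pair_coverI[where \<B> = "(`) f ` \<B>"])
    show "card ((`) f ` \<B>) \<le> b"
      using card_image_le[OF \<B>(1), of "(`) f"] \<B>(2) by linarith
    show "card B = k" if "B \<in> (`) f ` \<B>" for B
      using that \<B>(3,4) inj by (auto simp: card_image inj_on_subset)
    show "\<exists>B\<in>(`) f ` \<B>. x \<in> B \<and> y \<in> B" if "x \<in> W" "y \<in> W" "x \<noteq> y" for x y
    proof -
      from that obtain u v where "u \<in> V" "v \<in> V" "x = f u" "y = f v" "u \<noteq> v"
        unfolding W by auto
      then obtain B where "B \<in> \<B>" "u \<in> B" "v \<in> B"
        using \<B>(5) by blast
      then show ?thesis
        using \<open>x = f u\<close> \<open>y = f v\<close> by blast
    qed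
  qed (use \<B> W in auto)
qed

lemma pair_cover_card_eq:
  assumes "finite V" "finite W" "card V = card W" "pair_cover (\<noteq>) V k b"
  shows "pair_cover (\<noteq>) W k b"
proof -
  from finite_same_card_bij[OF assms(1-3)] obtain f where "bij_betw f V W" ..
  then show ?thesis
    using assms(4) by (rule pair_cover_bij)
qed

text \<open>Counting incidences between pairs and blocks in two ways shows that a pair lies in at
  most one block on average. Every pair lies in at least one, so each lies in exactly one.\<close>

lemma two_design_of_pair_cover:
  assumes V: "finite V" and cov: "pair_cover (\<noteq>) V k b"
    and b: "b * (k choose 2) \<le> card V choose 2"
  shows "\<exists>\<A>. two_design (card V) k 1 V \<A>"
proof -
  from cov obtain \<B> where \<B>: "finite \<B>" "card \<B> \<le> b" "\<forall>B\<in>\<B>. B \<subseteq> V" "\<forall>B\<in>\<B>. card B = k"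
      "\<forall>x\<in>V. \<forall>y\<in>V. x \<noteq> y \<longrightarrow> (\<exists>B\<in>\<B>. x \<in> B \<and> y \<in> B)"
    by (rule pair_coverE)
  define P where "P = {T. T \<subseteq> V \<and> card T = 2}"
  define n where "n T = card {B \<in> \<B>. T \<subseteq> B}" for T
  have finP: "finite P"
    by (rule finite_subset[of _ "Pow V"]) (use V in \<open>auto simp: P_def\<close>)
  have n_pos: "1 \<le> n T" if "T \<in> P" for T
  proof -
    from that obtain x y where xy: "T = {x, y}" "x \<noteq> y" "x \<in> V" "y \<in> V"
      by (auto simp: P_def card_2_iff)
    then obtain B where "B \<in> \<B>" "T \<subseteq> B"
      using \<B>(5) by auto
    then have "{B \<in> \<B>. T \<subseteq> B} \<noteq> {}"
      by blast
    then show ?thesis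
      using \<B>(1) by (simp add: n_def Suc_le_eq card_gt_0_iff)
  qed
  have "(\<Sum>T\<in>P. n T) = (\<Sum>T\<in>P. \<Sum>B\<in>{B \<in> \<B>. T \<subseteq> B}. 1)"
    by (simp add: n_def)
  also have "\<dots> = (\<Sum>B\<in>\<B>. \<Sum>T\<in>{T \<in> P. T \<subseteq> B}. 1)"
    by (rule sum.swap_restrict[OF finP \<B>(1)])
  also have "\<dots> = (\<Sum>B\<in>\<B>. k choose 2)"
  proof (rule sum.cong[OF refl])
    fix B assume B: "B \<in> \<B>"
    have "{T \<in> P. T \<subseteq> B} = {T. T \<subseteq> B \<and> card T = 2}"
      using \<B>(3) B by (auto simp: P_def)
    then show "(\<Sum>T\<in>{T \<in> P. T \<subseteq> B}. 1) = k choose 2"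
      using n_subsets[of B 2] \<B>(3,4) B finite_subset[OF _ V] by auto
  qed
  also have "\<dots> \<le> b * (k choose 2)"
    using \<B>(2) by simp
  also have "\<dots> \<le> card P"
    using b n_subsets[OF V, of 2] by (simp add: P_def)
  finally have total: "(\<Sum>T\<in>P. n T) \<le> (\<Sum>T\<in>P. 1)"
    by simp
  have n_one: "n T = 1" if "T \<in> P" for T
  proof (rule ccontr)
    assume "n T \<noteq> 1"
    then have "\<exists>T\<in>P. 1 < n T"
      using n_pos[OF that] that by (intro bexI[of _ T]) auto
    then have "(\<Sum>T\<in>P. 1) < (\<Sum>T\<in>P. n T)"
      using n_pos finP by (intro sum_strict_mono_ex1) auto
    then show False
      using total by linarith
  qed
  have "two_design (card V) k 1 V (mset_set \<B>)"
    unfolding two_design_def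
  proof (intro conjI allI impI)
    fix T assume "T \<subseteq> V \<and> card T = 2"
    then have "n T = 1"
      by (intro n_one) (simp add: P_def)
    then show "size {#B \<in># mset_set \<B>. T \<subseteq> B#} = 1"
      using \<B>(1) by (simp add: n_def filter_mset_mset_set)
  qed (use V \<B> in auto)
  then show ?thesis ..
qed

section \<open>Filling holes and translating base blocks\<close>

text \<open>The index set \<open>I\<close> is empty or a single point at infinity shared by all holes.\<close>

lemma pair_cover_fill_holes:
  fixes V :: "'a set" and I :: "'a option set"
  assumes C: "finite C" "cl ` V \<subseteq> C"
    and I: "I \<subseteq> {None}"
    and cross: "pair_cover (\<lambda>x y. cl x \<noteq> cl y) V k b1"
    and hole: "\<And>c. c \<in> C \<Longrightarrow> pair_cover (\<noteq>) (Some ` {x \<in> V. cl x = c} \<union> I) k b2"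
    and b: "b1 + card C * b2 \<le> b"
  shows "pair_cover (\<noteq>) (Some ` V \<union> I) k b"
proof -
  from cross obtain \<B> where \<B>: "finite \<B>" "card \<B> \<le> b1" "\<forall>B\<in>\<B>. B \<subseteq> V" "\<forall>B\<in>\<B>. card B = k"
      "\<forall>x\<in>V. \<forall>y\<in>V. cl x \<noteq> cl y \<longrightarrow> (\<exists>B\<in>\<B>. x \<in> B \<and> y \<in> B)"
    by (rule pair_coverE)
  define H where "H c = Some ` {x \<in> V. cl x = c} \<union> I" for c
  have "\<forall>c\<in>C. \<exists>\<D>. finite \<D> \<and> card \<D> \<le> b2 \<and> (\<forall>B\<in>\<D>. B \<subseteq> H c \<and> card B = k) \<and>
      (\<forall>x\<in>H c. \<forall>y\<in>H c. x \<noteq> y \<longrightarrow> (\<exists>B\<in>\<D>. x \<in> B \<and> y \<in> B))"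
    using hole unfolding pair_cover_def H_def by (rule ballI)
  from bchoice[OF this] obtain \<D> where \<D>: "\<forall>c\<in>C. finite (\<D> c) \<and> card (\<D> c) \<le> b2 \<and>
      (\<forall>B\<in>\<D> c. B \<subseteq> H c \<and> card B = k) \<and>
      (\<forall>x\<in>H c. \<forall>y\<in>H c. x \<noteq> y \<longrightarrow> (\<exists>B\<in>\<D> c. x \<in> B \<and> y \<in> B))"
    by (rule exE)
  then have \<D>_fin: "finite (\<D> c)" "card (\<D> c) \<le> b2"
    and \<D>_block: "\<And>B. B \<in> \<D> c \<Longrightarrow> B \<subseteq> H c" "\<And>B. B \<in> \<D> c \<Longrightarrow> card B = k"
    and \<D>_pair: "\<And>x y. x \<in> H c \<Longrightarrow> y \<in> H c \<Longrightarrow> x \<noteq> y \<Longrightarrow> \<exists>B\<in>\<D> c. x \<in> B \<and> y \<in> B"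
    if "c \<in> C" for c
    using that by simp_all
  have H_sub: "H c \<subseteq> Some ` V \<union> I" for c
    by (auto simp: H_def)
  let ?\<B> = "(`) Some ` \<B> \<union> (\<Union>c\<in>C. \<D> c)"
  show ?thesis
  proof (rule pair_coverI[where \<B> = ?\<B>])
    show "finite ?\<B>"
      using \<B>(1) \<D>_fin C(1) by simp
    have "card (\<Union>c\<in>C. \<D> c) \<le> (\<Sum>c\<in>C. card (\<D> c))"
      by (rule card_UN_le[OF C(1)])
    also have "\<dots> \<le> card C * b2"
      using \<D>_fin sum_bounded_above[of C "\<lambda>c. card (\<D> c)" b2] by simp
    finally show "card ?\<B> \<le> b"
      using \<B>(2) b card_Un_le[of "(`) Some ` \<B>" "\<Union>c\<in>C. \<D> c"]
        card_image_le[OF \<B>(1), of "(`) Some"] by linarith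
    show "B \<subseteq> Some ` V \<union> I" if "B \<in> ?\<B>" for B
    proof -
      consider A where "A \<in> \<B>" "B = Some ` A" | c where "c \<in> C" "B \<in> \<D> c"
        using \<open>B \<in> ?\<B>\<close> by auto
      then show ?thesis
      proof cases
        case 1
        then show ?thesis
          using \<B>(3) by auto
      next
        case 2
        then show ?thesis
          using \<D>_block(1) H_sub by (meson subset_trans)
      qed
    qed
    show "card B = k" if "B \<in> ?\<B>" for B
      using that \<B>(4) \<D>_block(2) by (auto simp: card_image)
    fix x y assume xy: "x \<in> Some ` V \<union> I" "y \<in> Some ` V \<union> I" "x \<noteq> y"
    \<comment> \<open>The point at infinity, if present, lies in every hole, so the only pairs
      without a common hole are finite points of different classes.\<close>
    consider u v where "x = Some u" "y = Some v" "u \<in> V" "v \<in> V" "cl u \<noteq> cl v"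
      | c where "c \<in> C" "x \<in> H c" "y \<in> H c"
    proof -
      show thesis
      proof (cases x)
        case x: None
        show thesis
        proof (cases y)
          case y: None
          with x xy(3) show thesis
            by simp
        next
          case y: (Some v)
          with x xy I C(2) show thesis
            by (intro that(2)[of "cl v"]) (auto simp: H_def)
        qed
      next
        case x: (Some u)
        show thesis
        proof (cases y)
          case y: None
          with x xy I C(2) show thesis
            by (intro that(2)[of "cl u"]) (auto simp: H_def)
        next
          case y: (Some v)
          with x xy I C(2) show thesis
            by (cases "cl u = cl v", intro that(2)[of "cl u"]) (auto simp: H_def intro: that(1))
        qed
      qed
    qed
    then show "\<exists>B\<in>?\<B>. x \<in> B \<and> y \<in> B"
    proof cases
      case 1
      then obtain B where "B \<in> \<B>" "u \<in> B" "v \<in> B"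
        using \<B>(5) by blast
      then show ?thesis
        using 1 by (intro bexI[of _ "Some ` B"]) auto
    next
      case 2
      then show ?thesis
        using \<D>_pair[of c x y] xy(3) by blast
    qed
  qed
qed

text \<open>\<open>\<rho>\<close> picks representatives modulo the subgroup of all \<open>x\<close>
  with \<open>\<rho> x = \<rho> 0\<close>, so \<open>range \<rho>\<close> stands for a finite
  quotient group. Translation by \<open>x - p\<close> carries \<open>p\<close> to \<open>x\<close>,
  and carries \<open>q\<close> to \<open>y\<close> once \<open>x - y\<close> and
  \<open>p - q\<close> agree in the quotient.\<close>

lemma pair_cover_translates:
  fixes \<rho> :: "'a::ab_group_add \<Rightarrow> 'a"
  assumes idem: "\<And>x. \<rho> (\<rho> x) = \<rho> x"
    and cong: "\<And>x y. \<rho> x = \<rho> y \<longleftrightarrow> \<rho> (x - y) = \<rho> 0"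
    and fin: "finite (range \<rho>)"
    and F: "finite F" "\<And>T. T \<in> F \<Longrightarrow> T \<subseteq> range \<rho>" "\<And>T. T \<in> F \<Longrightarrow> card T = k"
    and diff: "\<And>x y. x \<in> range \<rho> \<Longrightarrow> y \<in> range \<rho> \<Longrightarrow> r x y \<Longrightarrow>
                \<exists>T\<in>F. \<exists>p\<in>T. \<exists>q\<in>T. \<rho> (x - y) = \<rho> (p - q)"
    and b: "card (range \<rho>) * card F \<le> b"
  shows "pair_cover r (range \<rho>) k b"
proof (rule pair_coverI[where \<B> = "(\<lambda>(s, T). (\<lambda>p. \<rho> (s + p)) ` T) ` (range \<rho> \<times> F)"])
  let ?\<B> = "(\<lambda>(s, T). (\<lambda>p. \<rho> (s + p)) ` T) ` (range \<rho> \<times> F)"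
  have fix_range: "\<rho> x = x" if "x \<in> range \<rho>" for x
    using that idem by auto
  have add0: "\<rho> (u + v) = \<rho> 0" if "\<rho> u = \<rho> 0" "\<rho> v = \<rho> 0" for u v
    using that cong[of "u + v" v] by simp
  show "finite ?\<B>"
    using fin F(1) by simp
  show "card ?\<B> \<le> b"
    using card_image_le[of "range \<rho> \<times> F" "\<lambda>(s, T). (\<lambda>p. \<rho> (s + p)) ` T"] fin F(1) b
    by (simp add: card_cartesian_product)
  show "card B = k" if "B \<in> ?\<B>" for B
  proof -
    from that obtain s T where T: "T \<in> F" "B = (\<lambda>p. \<rho> (s + p)) ` T"
      by auto
    have "inj_on (\<lambda>p. \<rho> (s + p)) T"
    proof (rule inj_onI)
      fix p q assume pq: "p \<in> T" "q \<in> T" "\<rho> (s + p) = \<rho> (s + q)"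
      then have "\<rho> p = \<rho> q"
        using cong[of "s + p" "s + q"] cong[of p q] by simp
      moreover have "\<rho> p = p" "\<rho> q = q"
        using F(2)[OF T(1)] pq by (auto intro: fix_range)
      ultimately show "p = q"
        by simp
    qed
    then show ?thesis
      using F(3) T by (simp add: card_image)
  qed
  show "\<exists>B\<in>?\<B>. x \<in> B \<and> y \<in> B" if xy: "x \<in> range \<rho>" "y \<in> range \<rho>" "r x y" for x y
  proof -
    from diff[OF xy] obtain T p q where T: "T \<in> F" "p \<in> T" "q \<in> T" "\<rho> (x - y) = \<rho> (p - q)"
      by (elim bexE)
    define s where "s = \<rho> (x - p)"
    have s0: "\<rho> (s - (x - p)) = \<rho> 0"
      using cong[of s "x - p"] idem by (simp add: s_def)
    have "\<rho> (s + p) = x"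
      using s0 cong[of "s + p" x] fix_range[OF xy(1)] by (simp add: algebra_simps)
    moreover have "\<rho> (s + q) = y"
    proof -
      have "\<rho> ((x - y) - (p - q)) = \<rho> 0"
        by (rule iffD1[OF cong T(4)])
      from add0[OF s0 this] have "\<rho> (s + q - y) = \<rho> 0"
        by (simp add: algebra_simps)
      then show ?thesis
        using cong[of "s + q" y] fix_range[OF xy(2)] by simp
    qed
    ultimately have "x \<in> (\<lambda>p. \<rho> (s + p)) ` T" "y \<in> (\<lambda>p. \<rho> (s + p)) ` T"
      using T(2,3) by blast+
    then show ?thesis
      using T(1) by (intro bexI[of _ "(\<lambda>p. \<rho> (s + p)) ` T"] conjI image_eqI[of _ _ "(s, T)"])
        (simp_all add: s_def)
  qed
qed auto

section \<open>Affine planes of orders 8 and 9\<close>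

lemma range_mod_int:
  fixes n :: int
  assumes "n > 0"
  shows "range (\<lambda>x. x mod n) = {0..<n}"
proof
  show "{0..<n} \<subseteq> range (\<lambda>x. x mod n)"
  proof
    fix x assume "x \<in> {0..<n}"
    then have "x = x mod n"
      by simp
    then show "x \<in> range (\<lambda>x. x mod n)"
      by (rule range_eqI)
  qed
qed (use assms in auto)

lemma card_residue_class:
  fixes d n c :: int
  assumes d: "d > 0" and c: "c \<in> {0..<d}"
  shows "card {x \<in> {0..<d * n}. x mod d = c} = nat n"
proof -
  have "bij_betw (\<lambda>i. c + d * i) {0..<n} {x \<in> {0..<d * n}. x mod d = c}"
  proof (rule bij_betwI[where g = "\<lambda>x. x div d"])
    show "(\<lambda>i. c + d * i) \<in> {0..<n} \<rightarrow> {x \<in> {0..<d * n}. x mod d = c}"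
    proof
      fix i assume i: "i \<in> {0..<n}"
      then have "d * (i + 1) \<le> d * n"
        using d by (intro mult_left_mono) auto
      then show "c + d * i \<in> {x \<in> {0..<d * n}. x mod d = c}"
        using c d i by (simp add: algebra_simps)
    qed
    show "(\<lambda>x. x div d) \<in> {x \<in> {0..<d * n}. x mod d = c} \<rightarrow> {0..<n}"
    proof
      fix x assume x: "x \<in> {x \<in> {0..<d * n}. x mod d = c}"
      have "d * (x div d) \<le> x"
        using d mult_div_mod_eq[of d x] pos_mod_sign[of d x] by linarith
      also have "x < d * n"
        using x by simp
      finally have "x div d < n"
        using d by simp
      then show "x div d \<in> {0..<n}"
        using d x by (simp add: pos_imp_zdiv_nonneg_iff)
    qed
  qed (use c d in auto)
  then show ?thesis
    using bij_betw_same_card by fastforce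
qed

lemma card_Some_Un_None:
  assumes "finite A"
  shows "card (Some ` A \<union> {None}) = Suc (card A)"
  using assms by (simp add: card_image image_iff)

text \<open>The affine plane of order \<open>q\<close> minus a point is the development of Bose's difference set
  modulo \<open>q\<^sup>2 - 1\<close>; the lines through the removed point come from the multiples of \<open>q + 1\<close>.\<close>

lemma affine_plane_pair_cover:
  fixes q :: nat and D :: "int list"
  assumes N: "N = int (q * q - 1)" and q: "q \<ge> 2"
    and D: "length D = q" "distinct D" "set D \<subseteq> {0..<N}"
    and diffs: "\<And>d. 0 \<le> d \<Longrightarrow> d < N \<Longrightarrow> d mod int (q + 1) \<noteq> 0 \<Longrightarrow>
                  d \<in> set [(p - q) mod N. p \<leftarrow> D, q \<leftarrow> D]"
    and W: "finite W" "card W = q * q"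
  shows "pair_cover (\<noteq>) W q (q * q + q)"
proof -
  let ?\<rho> = "\<lambda>x. x mod N"
  have N_fac: "N = int (q + 1) * int (q - 1)"
    using q unfolding N by (simp add: of_nat_diff algebra_simps)
  have N_pos: "N > 0"
    using q unfolding N_fac by simp
  have range: "range ?\<rho> = {0..<N}"
    using N_pos by (rule range_mod_int)
  \<comment> \<open>Since \<open>N = (q + 1) * (q - 1)\<close>, residues modulo \<open>q + 1\<close>
    are well defined modulo \<open>N\<close>; two points in different classes differ by a
    non-multiple of \<open>q + 1\<close>.\<close>
  have cross: "pair_cover (\<lambda>x y. x mod int (q + 1) \<noteq> y mod int (q + 1)) {0..<N} q (q * q - 1)"
    unfolding range[symmetric]
  proof (rule pair_cover_translates[where F = "{set D}"])
    fix x y assume "x mod int (q + 1) \<noteq> y mod int (q + 1)"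
    moreover have "int (q + 1) dvd N"
      unfolding N_fac by simp
    ultimately have "(x - y) mod N mod int (q + 1) \<noteq> 0"
      by (simp add: mod_mod_cancel mod_eq_dvd_iff flip: dvd_eq_mod_eq_0)
    then have "(x - y) mod N \<in> set [(p - q) mod N. p \<leftarrow> D, q \<leftarrow> D]"
      using N_pos by (intro diffs) auto
    then show "\<exists>T\<in>{set D}. \<exists>p\<in>T. \<exists>q\<in>T. (x - y) mod N = (p - q) mod N"
      by auto
  next
    show "x mod N = y mod N \<longleftrightarrow> (x - y) mod N = 0 mod N" for x y
      by (simp add: mod_eq_dvd_iff dvd_eq_mod_eq_0)
  qed (use D range N in \<open>auto simp: distinct_card\<close>)
  have class_card: "card {x \<in> {0..<N}. x mod int (q + 1) = c} = q - 1"
    if c: "c \<in> {0..<int (q + 1)}" for c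
    using card_residue_class[OF _ c, of "int (q - 1)"] unfolding N_fac by simp
  \<comment> \<open>Each of the \<open>q + 1\<close> classes has \<open>q - 1\<close> points and
    becomes a single line when \<open>None\<close>, the removed point, is added.\<close>
  have "pair_cover (\<noteq>) (Some ` {0..<N} \<union> {None}) q (q * q + q)"
  proof (rule pair_cover_fill_holes[where C = "{0..<int (q + 1)}" and ?b2.0 = 1, OF _ _ _ cross])
    fix c assume c: "c \<in> {0..<int (q + 1)}"
    have "finite {x \<in> {0..<N}. x mod int (q + 1) = c}"
      by (rule finite_subset[of _ "{0..<N}"]) auto
    from card_Some_Un_None[OF this] show "pair_cover (\<noteq>) (Some ` {x \<in> {0..<N}. x mod int (q + 1) = c} \<union> {None}) q 1"
      using class_card[OF c] q by (intro pair_cover_single) simp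
  next
    show "q * q - 1 + card {0..<int (q + 1)} * 1 \<le> q * q + q"
      using q by (cases q) auto
  qed auto
  moreover have "card (Some ` {0..<N} \<union> {None}) = card W"
  proof -
    have "card (Some ` {0..<N} \<union> {None}) = Suc (card {0..<N})"
      by (rule card_Some_Un_None) simp
    also have "card {0..<N} = q * q - 1"
      unfolding N by (simp only: card_atLeastLessThan_int diff_0_right nat_int)
    finally show ?thesis
      using q W(2) by (cases q) simp_all
  qed
  ultimately show ?thesis
    using W(1) by (intro pair_cover_card_eq[OF _ W(1)]) simp_all
qed

lemma affine_plane_8:
  assumes "finite W" "card W = 64"
  shows "pair_cover (\<noteq>) W 8 72"
proof -
  let ?D = "[0, 1, 3, 7, 15, 20, 31, 41] :: int list"
  \<comment> \<open>The 56 ordered differences have to hit 63 - 7 = 56 residues, so each residue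
    occurs exactly once.\<close>
  have "\<forall>d\<in>set [0..62]. d mod 9 \<noteq> 0 \<longrightarrow> d \<in> set [(p - q) mod 63. p \<leftarrow> ?D, q \<leftarrow> ?D]"
    by code_simp
  then have "d \<in> set [(p - q) mod 63. p \<leftarrow> ?D, q \<leftarrow> ?D]"
    if "0 \<le> d" "d < 63" "d mod int (8 + 1) \<noteq> 0" for d
    using that unfolding set_upto by force
  then have "pair_cover (\<noteq>) W 8 (8 * 8 + 8)"
    using assms by (intro affine_plane_pair_cover[where N = 63 and D = ?D]) auto
  then show ?thesis
    by simp
qed

lemma affine_plane_9:
  assumes "finite W" "card W = 81"
  shows "pair_cover (\<noteq>) W 9 90"
proof -
  let ?D = "[0, 1, 3, 9, 22, 27, 34, 38, 66] :: int list"
  \<comment> \<open>Again the count is tight: 72 ordered differences for 80 - 8 residues.\<close>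
  have "\<forall>d\<in>set [0..79]. d mod 10 \<noteq> 0 \<longrightarrow> d \<in> set [(p - q) mod 80. p \<leftarrow> ?D, q \<leftarrow> ?D]"
    by code_simp
  then have "d \<in> set [(p - q) mod 80. p \<leftarrow> ?D, q \<leftarrow> ?D]"
    if "0 \<le> d" "d < 80" "d mod int (9 + 1) \<noteq> 0" for d
    using that unfolding set_upto by force
  then have "pair_cover (\<noteq>) W 9 (9 * 9 + 9)"
    using assms by (intro affine_plane_pair_cover[where N = 80 and D = ?D]) auto
  then show ?thesis
    by simp
qed

section \<open>Two orbits of base blocks under a cyclic group of order 24\<close>

text \<open>A triple \<open>(a, b, c)\<close> stands for the element \<open>(a + b \<surd>2, c)\<close> of
  \<open>(\<int>/15)[\<surd>2] \<times> \<int>/m\<close>. Since 2 is a non-residue modulo 3 and modulo 5, the first factor is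
  \<open>F\<^sub>9 \<times> F\<^sub>2\<^sub>5\<close>.\<close>

type_synonym triple = "int \<times> int \<times> int"

fun red :: "int \<Rightarrow> triple \<Rightarrow> triple" where
  "red m (a, b, c) = (a mod 15, b mod 15, c mod m)"

fun cmul :: "triple \<Rightarrow> triple \<Rightarrow> triple" where
  "cmul (a, b, c) (a', b', c') = (a * a' + 2 * b * b', a * b' + b * a', c * c')"

text \<open>The image of \<open>3 + 11 \<surd>2\<close> generates the multiplicative group of \<open>F\<^sub>2\<^sub>5\<close> and has
  order 4 in \<open>F\<^sub>9\<close>.\<close>

definition act :: "int \<Rightarrow> int \<Rightarrow> triple \<Rightarrow> triple" where
  "act m w x = red m (cmul (3, 11, w) x)"

text \<open>The component in the field of order 25, whose elements are the classes to be
  separated.\<close>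

fun cls :: "triple \<Rightarrow> int \<times> int" where
  "cls (a, b, c) = (a mod 5, b mod 5)"

text \<open>Multiplication by 3 + sqrt 2, to which the generator reduces modulo 5 because 11 is 1
  modulo 5.\<close>

fun act5 :: "int \<times> int \<Rightarrow> int \<times> int" where
  "act5 (a, b) = ((3 * a + 2 * b) mod 5, (a + 3 * b) mod 5)"

text \<open>Moves along the orbit until the component in the field of order 25 is 1. Running out of
  fuel is harmless, as the result still lies in the orbit.\<close>

fun normalize5 :: "int \<Rightarrow> int \<Rightarrow> nat \<Rightarrow> triple \<Rightarrow> triple" where
  "normalize5 m w 0 x = x"
| "normalize5 m w (Suc n) x = (if cls x = (1, 0) then x else normalize5 m w n (act m w x))"

section \<open>Arithmetic of the action on triples\<close>

lemma range_red:
  assumes "m > 0"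
  shows "range (red m) = {0..<15} \<times> {0..<15} \<times> {0..<m}"
proof
  show "{0..<15} \<times> {0..<15} \<times> {0..<m} \<subseteq> range (red m)"
  proof
    fix x :: triple assume "x \<in> {0..<15} \<times> {0..<15} \<times> {0..<m}"
    then have "x = red m x"
      by (cases x) simp
    then show "x \<in> range (red m)"
      by (rule range_eqI)
  qed
qed (use assms in auto)

lemma red_red [simp]: "red m (red m x) = red m x"
  by (cases x) simp

lemma red_eq_iff: "red m x = red m y \<longleftrightarrow> red m (x - y) = red m 0"
  by (cases x; cases y) (simp add: zero_prod_def mod_eq_dvd_iff dvd_eq_mod_eq_0)

lemma red_range: "x \<in> range (red m) \<Longrightarrow> red m x = x"
  by auto

lemma red_cmul_red1: "red m (cmul (red m x) y) = red m (cmul x y)"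
  by (cases x; cases y) (simp add: mod_simps; intro conjI mod_add_cong mod_mult_cong; simp)

lemma red_cmul_red2: "red m (cmul x (red m y)) = red m (cmul x y)"
  by (cases x; cases y) (simp add: mod_simps; intro conjI mod_add_cong mod_mult_cong; simp)

lemma red_diff: "red m (red m x - red m y) = red m (x - y)"
  by (cases x; cases y) (simp add: mod_simps)

lemma cmul_diff: "cmul x (y - z) = cmul x y - cmul x z"
  by (cases x; cases y; cases z) (simp add: algebra_simps)

lemma cmul_assoc: "cmul (cmul x y) z = cmul x (cmul y z)"
  by (cases x; cases y; cases z) (simp add: algebra_simps)

lemma act_red_diff: "act m w (red m (x - y)) = red m (act m w x - act m w y)"
  by (simp add: act_def red_cmul_red2 red_diff cmul_diff)

lemma act_in_range: "act m w x \<in> range (red m)"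
  by (simp add: act_def)

lemma act_funpow_in_range: "x \<in> range (red m) \<Longrightarrow> (act m w ^^ i) x \<in> range (red m)"
  by (cases i) (simp_all add: act_in_range)

lemma act_funpow_diff: "(act m w ^^ i) (red m (x - y)) = red m ((act m w ^^ i) x - (act m w ^^ i) y)"
  by (induction i) (simp_all add: act_red_diff)

text \<open>The triple \<open>(1, 0, 1)\<close> is the unit of \<open>cmul\<close>, so the period of
  the whole action can be tested on this one element.\<close>

lemma act_funpow_eq_cmul:
  "x \<in> range (red m) \<Longrightarrow> (act m w ^^ i) x = red m (cmul ((act m w ^^ i) (1, 0, 1)) x)"
proof (induction i)
  case 0
  then show ?case
    by (cases x) (auto dest: red_range)
next
  case (Suc i)
  then show ?case
    by (simp add: act_def red_cmul_red1 red_cmul_red2 cmul_assoc)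
qed

lemma cls_act: "cls (act m w x) = act5 (cls x)"
  by (cases x) (simp add: act_def mod_mod_cancel mod_simps; simp add: mod_eq_dvd_iff; presburger)

lemma cls_act_funpow: "cls ((act m w ^^ i) x) = (act5 ^^ i) (cls x)"
  by (induction i) (simp_all add: cls_act)

text \<open>The 24 powers of a generator exhaust the nonzero field elements; this is checked by
  enumeration.\<close>

lemma act5_transitive:
  assumes "cls x \<noteq> (0, 0)"
  shows "\<exists>i<24. (act5 ^^ i) (cls x) = (1, 0)"
proof -
  have "\<forall>a\<in>set [0..4]. \<forall>b\<in>set [0..4]. (a, b) \<noteq> (0, 0) \<longrightarrow>
          (\<exists>i\<in>set [0..<24]. (act5 ^^ i) (a, b) = (1, 0))"
    by code_simp
  moreover have "fst (cls x) \<in> set [0..4]" "snd (cls x) \<in> set [0..4]"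
    unfolding set_upto using pos_mod_bound[of 5] pos_mod_sign[of 5] by (cases x; force)+
  ultimately have "(fst (cls x), snd (cls x)) \<noteq> (0, 0) \<longrightarrow>
      (\<exists>i\<in>set [0..<24]. (act5 ^^ i) (fst (cls x), snd (cls x)) = (1, 0))"
    by blast
  then show ?thesis
    using assms by auto
qed

section \<open>Differences of the base blocks\<close>

lemma cls_diff_nonzero:
  assumes "cls x \<noteq> cls y"
  shows "cls (red m (x - y)) \<noteq> (0, 0)"
proof (cases x; cases y)
  fix a b c a' b' c' :: int
  assume xy: "x = (a, b, c)" "y = (a', b', c')"
  have "u mod 5 = v mod 5 \<longleftrightarrow> (u - v) mod 5 = 0" for u v :: int
    by (simp only: mod_eq_dvd_iff dvd_eq_mod_eq_0)
  with assms show ?thesis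
    unfolding xy by (simp add: mod_mod_cancel)
qed

lemma normalize5_eq_funpow: "\<exists>i. normalize5 m w n x = (act m w ^^ i) x"
proof (induction n arbitrary: x)
  case 0
  show ?case
    by (auto intro: exI[of _ 0])
next
  case (Suc n)
  then obtain i where "normalize5 m w n (act m w x) = (act m w ^^ i) (act m w x)"
    by blast
  then show ?case
    by (auto simp: funpow_swap1 intro: exI[of _ 0] exI[of _ "Suc i"])
qed

text \<open>Used with period 3 for \<open>S\<close> and 24 for \<open>B\<close>: finitely many
  listed images then contain the images under all powers.\<close>

lemma funpow_image_periodic:
  assumes "(f ^^ t) ` X = X"
  shows "(f ^^ i) ` X = (f ^^ (i mod t)) ` X"
proof -
  have "(f ^^ (t * j)) ` X = X" for j
    using assms by (induction j) (simp_all add: funpow_add flip: image_image image_comp)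
  then have "(f ^^ (i mod t + t * (i div t))) ` X = (f ^^ (i mod t)) ` X"
    by (simp only: funpow_add image_comp[symmetric])
  then show ?thesis
    by simp
qed

lemma mem_list_pairs:
  "e \<in> set [f p q. X \<leftarrow> Xs, p \<leftarrow> X, q \<leftarrow> X] \<longleftrightarrow>
     (\<exists>X\<in>set Xs. \<exists>p\<in>set X. \<exists>q\<in>set X. e = f p q)"
  by auto

text \<open>A difference between distinct classes is moved by a power of the action to component 1,
  where \<open>diffs\<close> exhibits it as a moved difference of \<open>S\<close> or
  \<open>B\<close>. Undoing the power makes it a difference of one of the 3 + 24 images.\<close>

lemma pair_cover_cross:
  fixes S B :: "triple list"
  assumes m: "m > 0"
    and order: "(act m w ^^ 24) (1, 0, 1) = (1, 0, 1)"
    and S: "\<forall>x\<in>set S. red m x = x" "distinct S" "length S = k"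
    and B: "\<forall>x\<in>set B. red m x = x" "distinct B" "length B = k"
    and S_inv: "(act m w ^^ 3) ` set S = set S"
    and diffs: "\<forall>a\<in>set [0..2]. \<forall>b\<in>set [0..2]. \<forall>c\<in>set [0..m - 1]. (1 + 5 * a, 5 * b, c) \<in>
        set [normalize5 m w 24 (red m (p - q)). X \<leftarrow> [S, B], p \<leftarrow> X, q \<leftarrow> X]"
  shows "pair_cover (\<lambda>x y. cls x \<noteq> cls y) (range (red m)) k (card (range (red m)) * 27)"
proof -
  let ?g = "act m w"
  define F where "F = (\<lambda>i. (?g ^^ i) ` set S) ` {..<3} \<union> (\<lambda>i. (?g ^^ i) ` set B) ` {..<24}"
  have fin: "finite (range (red m))"
    unfolding range_red[OF m] by simp
  have period: "(?g ^^ 24) x = x" if "x \<in> range (red m)" for x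
    using act_funpow_eq_cmul[OF that, where i = 24 and w = w] red_range[OF that] order by (cases x) simp
  have inj: "inj_on (?g ^^ i) (range (red m))" for i
  proof (rule inj_onI)
    fix x y assume xy: "x \<in> range (red m)" "y \<in> range (red m)" "(?g ^^ i) x = (?g ^^ i) y"
    \<comment> \<open>By periodicity the power \<open>23 * i\<close> is a left inverse of the power
      \<open>i\<close>.\<close>
    have "((?g ^^ 24) ^^ i) z = z" if "z \<in> range (red m)" for z
      using that by (induction i) (simp_all add: period)
    moreover have "((?g ^^ 24) ^^ i) z = (?g ^^ (23 * i)) ((?g ^^ i) z)" for z
      by (simp add: funpow_mult flip: funpow_add[THEN fun_cong, unfolded o_apply])
    ultimately show "x = y"
      using xy by metis
  qed
  have X_range: "set S \<subseteq> range (red m)" "set B \<subseteq> range (red m)"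
    using S(1) B(1) by (metis rangeI subsetI)+
  have B_inv: "(?g ^^ 24) ` set B = set B"
  proof -
    have "(?g ^^ 24) ` set B = (\<lambda>x. x) ` set B"
      by (intro image_cong refl period subsetD[OF X_range(2)])
    then show ?thesis
      by simp
  qed
  have F_mem: "(?g ^^ i) ` set X \<in> F" if "X \<in> set [S, B]" for i X
    using that funpow_image_periodic[OF S_inv, of i] funpow_image_periodic[OF B_inv, of i]
    by (auto simp: F_def)
  show ?thesis
  proof (rule pair_cover_translates[where F = F])
    show "finite F"
      by (simp add: F_def)
    have "card F \<le> 3 + 24"
      unfolding F_def using card_image_le[of "{..<3::nat}" "\<lambda>i. (?g ^^ i) ` set S"]
        card_image_le[of "{..<24::nat}" "\<lambda>i. (?g ^^ i) ` set B"]
      by (intro order.trans[OF card_Un_le] add_mono) simp_all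
    then show "card (range (red m)) * card F \<le> card (range (red m)) * 27"
      by simp
    fix T assume "T \<in> F"
    then have "\<exists>i X. T = (?g ^^ i) ` X \<and> (X = set S \<or> X = set B)"
      by (auto simp: F_def)
    then obtain i X where T: "T = (?g ^^ i) ` X" "X = set S \<or> X = set B"
      by (elim exE conjE)
    then have X: "X \<subseteq> range (red m)" "card X = k"
      using X_range S(2,3) B(2,3) by (elim disjE; simp add: distinct_card)+
    show "T \<subseteq> range (red m)"
      unfolding T(1)
    proof (rule image_subsetI)
      fix x assume "x \<in> X"
      with X(1) show "(?g ^^ i) x \<in> range (red m)"
        by (intro act_funpow_in_range) (rule subsetD)
    qed
    show "card T = k"
      unfolding T(1) using X by (subst card_image) (auto intro: inj_on_subset[OF inj])
  next
    fix x y assume xy: "cls x \<noteq> cls y"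
    define d where "d = red m (x - y)"
    have d: "d \<in> range (red m)"
      by (simp add: d_def)
    from act5_transitive[OF cls_diff_nonzero[OF xy], of m] obtain i where
      i: "i < 24" "cls ((?g ^^ i) d) = (1, 0)"
      unfolding d_def cls_act_funpow by blast
    define e where "e = (?g ^^ i) d"
    have "e \<in> range (red m)"
      unfolding e_def using d by (rule act_funpow_in_range)
    obtain e1 e2 e3 where e: "e = (e1, e2, e3)"
      by (cases e)
    have e_bounds: "0 \<le> e1" "e1 < 15" "0 \<le> e2" "e2 < 15" "0 \<le> e3" "e3 < m"
      using \<open>e \<in> range (red m)\<close> unfolding range_red[OF m] e by simp_all
    have "e1 mod 5 = 1" "e2 mod 5 = 0"
      using i(2) unfolding e_def[symmetric] e by simp_all
    then have "e1 = 1 + 5 * (e1 div 5)" "e2 = 5 * (e2 div 5)"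
      using mult_div_mod_eq[of 5 e1] mult_div_mod_eq[of 5 e2] by linarith+
    then have e': "e = (1 + 5 * (e1 div 5), 5 * (e2 div 5), e3)"
      unfolding e prod.inject by (intro conjI refl)
    have "e1 div 5 \<in> set [0..2]" "e2 div 5 \<in> set [0..2]" "e3 \<in> set [0..m - 1]"
      using e_bounds by auto
    then have "e \<in> set [normalize5 m w 24 (red m (p - q)). X \<leftarrow> [S, B], p \<leftarrow> X, q \<leftarrow> X]"
      unfolding e' by (rule diffs[rule_format])
    then obtain X p q where X: "X \<in> set [S, B]" "p \<in> set X" "q \<in> set X"
      "e = normalize5 m w 24 (red m (p - q))"
      unfolding mem_list_pairs by (elim bexE)
    obtain j where j: "e = (?g ^^ j) (red m (p - q))"
      using normalize5_eq_funpow X(4) by metis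
    \<comment> \<open>The power \<open>24 - i\<close> completes a full period and so returns from
      \<open>e\<close> to \<open>d\<close>.\<close>
    have "d = (?g ^^ (24 - i)) e"
      using i(1) period[OF d] unfolding e_def by (simp flip: funpow_add[THEN fun_cong, unfolded o_apply])
    also have "\<dots> = red m ((?g ^^ (24 - i + j)) p - (?g ^^ (24 - i + j)) q)"
      unfolding j by (simp add: act_funpow_diff flip: funpow_add[THEN fun_cong, unfolded o_apply])
    finally show "\<exists>T\<in>F. \<exists>p\<in>T. \<exists>q\<in>T. red m (x - y) = red m (p - q)"
      using F_mem[OF X(1), of "24 - i + j"] X(2,3) unfolding d_def
      by (intro bexI[of _ "(?g ^^ (24 - i + j)) ` set X"] bexI[of _ "(?g ^^ (24 - i + j)) p"]
          bexI[of _ "(?g ^^ (24 - i + j)) q"]) auto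
  qed (use fin red_eq_iff in auto)
qed

section \<open>Holes and assembly of the designs\<close>

lemma card_hole:
  assumes "m > 0" "c \<in> {0..<5} \<times> {0..<5}"
  shows "card {x \<in> range (red m). cls x = c} = 9 * nat m"
proof -
  obtain a b where c: "c = (a, b)" "a \<in> {0..<5}" "b \<in> {0..<5}"
    using assms(2) by blast
  have "{x \<in> range (red m). cls x = c} =
      {x \<in> {0..<5 * 3}. x mod 5 = a} \<times> {x \<in> {0..<5 * 3}. x mod 5 = b} \<times> {0..<m}"
    unfolding range_red[OF assms(1)] c(1) by auto
  then show ?thesis
    using card_residue_class[of 5 a 3] card_residue_class[of 5 b 3] c(2,3)
    by (simp add: card_cartesian_product)
qed

text \<open>The blocks are 27 per translate, over \<open>225 * nat m\<close> translates, and
  \<open>b\<close> for each of the 25 holes. In both applications \<open>count\<close> holds with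
  equality.\<close>

lemma two_design_of_cross:
  fixes I :: "triple option set"
  assumes m: "m > 0" and I: "I \<subseteq> {None}"
    and cross: "pair_cover (\<lambda>x y. cls x \<noteq> cls y) (range (red m)) k (card (range (red m)) * 27)"
    and hole: "\<And>W :: triple option set. finite W \<Longrightarrow> card W = 9 * nat m + card I \<Longrightarrow>
        pair_cover (\<noteq>) W k b"
    and v: "v = 225 * nat m + card I"
    and count: "(225 * nat m * 27 + 25 * b) * (k choose 2) \<le> v choose 2"
  shows "\<exists>(V :: nat set) \<A>. two_design v k 1 V \<A>"
proof -
  have finI: "finite I"
    using I by (rule finite_subset) simp
  have card_Un: "card (Some ` A \<union> I) = card A + card I" if "finite A" for A :: "triple set"
  proof -
    have "Some ` A \<inter> I = {}"
      using I by auto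
    then show ?thesis
      using that finI by (simp add: card_Un_disjoint card_image)
  qed
  have fin: "finite (range (red m))" and card_range: "card (range (red m)) = 225 * nat m"
    unfolding range_red[OF m] by (simp_all add: card_cartesian_product)
  have "pair_cover (\<noteq>) (Some ` range (red m) \<union> I) k (225 * nat m * 27 + 25 * b)"
  proof (rule pair_cover_fill_holes[where C = "{0..<5} \<times> {0..<5}", OF _ _ I cross])
    show "cls ` range (red m) \<subseteq> {0..<5} \<times> {0..<5}"
      unfolding range_red[OF m] by auto
    fix c :: "int \<times> int" assume c: "c \<in> {0..<5} \<times> {0..<5}"
    define H where "H = {x \<in> range (red m). cls x = c}"
    have "finite H"
      unfolding H_def using fin by (rule rev_finite_subset) (rule Collect_restrict)
    moreover have "card H = 9 * nat m"
      unfolding H_def using m c by (rule card_hole)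
    ultimately have "pair_cover (\<noteq>) (Some ` H \<union> I) k b"
      using finI by (intro hole) (simp_all add: card_Un)
    then show "pair_cover (\<noteq>) (Some ` {x \<in> range (red m). cls x = c} \<union> I) k b"
      unfolding H_def .
  next
    show "card (range (red m)) * 27 + card ({0..<5::int} \<times> {0..<5::int}) * b
        \<le> 225 * nat m * 27 + 25 * b"
      unfolding card_range card_cartesian_product by simp
  qed simp
  moreover have "card (Some ` range (red m) \<union> I) = card {..<v}"
    unfolding card_Un[OF fin] card_range v by (rule card_lessThan[symmetric])
  moreover have "finite (Some ` range (red m) \<union> I)"
    by (rule finite_UnI[OF finite_imageI[OF fin] finI])
  ultimately have "pair_cover (\<noteq>) {..<v} k (225 * nat m * 27 + 25 * b)"
    by (intro pair_cover_card_eq[OF _ finite_lessThan])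
  then have "\<exists>\<A>. two_design (card {..<v}) k 1 {..<v} \<A>"
    using count by (intro two_design_of_pair_cover[OF finite_lessThan]) (unfold card_lessThan)
  then show ?thesis
    unfolding card_lessThan by (rule exI)
qed

text \<open>In both cases \<open>S\<close> consists of the images of 1 under the powers of the third power of the
  generator, preceded by 0 when the block size is 9.\<close>

lemma cross_1575: "pair_cover (\<lambda>x y. cls x \<noteq> cls y) (range (red 7)) 8 (card (range (red 7)) * 27)"
proof (rule pair_cover_cross)
  let ?S = "[(1, 0, 1), (0, 4, 6), (2, 0, 1), (0, 8, 6), (4, 0, 1), (0, 1, 6), (8, 0, 1), (0, 2, 6)]
    :: triple list"
  let ?B = "[(0, 0, 0), (14, 14, 6), (5, 13, 0), (11, 9, 3), (14, 11, 1), (2, 2, 5), (9, 5, 0),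
    (7, 13, 2)] :: triple list"
  \<comment> \<open>The multiplier 3 is a primitive root modulo 7; its order 6 divides 24.\<close>
  show "(act 7 3 ^^ 24) (1, 0, 1) = (1, 0, 1)"
    by code_simp
  show "\<forall>x\<in>set ?S. red 7 x = x" "distinct ?S" "length ?S = 8"
    "\<forall>x\<in>set ?B. red 7 x = x" "distinct ?B" "length ?B = 8"
    by code_simp+
  show "(act 7 3 ^^ 3) ` set ?S = set ?S"
    by code_simp
  \<comment> \<open>There are 63 targets. The 56 ordered pairs of distinct elements of
    \<open>?B\<close> give 56 of them; those of \<open>?S\<close> fall into 7 orbits of length 8 and
    give the other 7.\<close>
  show "\<forall>a\<in>set [0..2]. \<forall>b\<in>set [0..2]. \<forall>c\<in>set [0..7 - 1]. (1 + 5 * a, 5 * b, c) \<in>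
      set [normalize5 7 3 24 (red 7 (p - q)). X \<leftarrow> [?S, ?B], p \<leftarrow> X, q \<leftarrow> X]"
    by code_simp
qed simp

lemma cross_2025: "pair_cover (\<lambda>x y. cls x \<noteq> cls y) (range (red 9)) 9 (card (range (red 9)) * 27)"
proof (rule pair_cover_cross)
  let ?S = "[(0, 0, 0), (1, 0, 1), (0, 4, 8), (2, 0, 1), (0, 8, 8), (4, 0, 1), (0, 1, 8), (8, 0, 1),
    (0, 2, 8)] :: triple list"
  let ?B = "[(0, 0, 0), (6, 4, 3), (2, 4, 0), (7, 0, 7), (5, 4, 7), (4, 11, 1), (4, 10, 8),
    (10, 6, 1), (7, 6, 6)] :: triple list"
  \<comment> \<open>The multiplier 2 is a primitive root modulo 9, again of order 6.\<close>
  show "(act 9 2 ^^ 24) (1, 0, 1) = (1, 0, 1)"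
    by code_simp
  show "\<forall>x\<in>set ?S. red 9 x = x" "distinct ?S" "length ?S = 9"
    "\<forall>x\<in>set ?B. red 9 x = x" "distinct ?B" "length ?B = 9"
    by code_simp+
  show "(act 9 2 ^^ 3) ` set ?S = set ?S"
    by code_simp
  \<comment> \<open>Here the 81 targets split as 72 from \<open>?B\<close> and 72 / 8 = 9 from
    \<open>?S\<close>.\<close>
  show "\<forall>a\<in>set [0..2]. \<forall>b\<in>set [0..2]. \<forall>c\<in>set [0..9 - 1]. (1 + 5 * a, 5 * b, c) \<in>
      set [normalize5 9 2 24 (red 9 (p - q)). X \<leftarrow> [?S, ?B], p \<leftarrow> X, q \<leftarrow> X]"
    by code_simp
qed simp

theorem theorem2p17:
  "(\<exists>(V :: nat set) \<A>. two_design 1576 8 1 V \<A>) \<and>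
   (\<exists>(V :: nat set) \<A>. two_design 2025 9 1 V \<A>)"
proof
  show "\<exists>(V :: nat set) \<A>. two_design 1576 8 1 V \<A>"
    by (rule two_design_of_cross[where m = 7 and I = "{None}" and b = 72])
      (simp_all add: cross_1575 affine_plane_8 choose_two)
  show "\<exists>(V :: nat set) \<A>. two_design 2025 9 1 V \<A>"
    by (rule two_design_of_cross[where m = 9 and I = "{}" and b = 90])
      (simp_all add: cross_2025 affine_plane_9 choose_two)
qed

end
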